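(* Let $\mathcal{E} = \langle \mathfrak{V}, \mathcal{T}, \Theta\rangle$ be a locally countable evolution system with the transition amalgamation property, and let $U$ be a $\mathfrak{V}$-object. The following conditions are equivalent. (a) Odd has a winning strategy in the game $\operatorname{BM}(\mathcal{E},U)$. (b) $U$ is the colimit of an evolution with the absorption property (for transitions).
   Context: An evolution system is a structure $\mathcal{E} = \langle \mathfrak{V}, \mathcal{T}, \Theta\rangle$ where $\mathfrak{V}$ is a (locally small) category, $\Theta$ is a fixed $\mathfrak{V}$-object (the origin), and $\mathcal{T}$ is a class of $\mathfrak{V}$-arrows (transitions) such that all identities are in $\mathcal{T}$, and $h\circ t \in \mathcal{T}$ whenever $t \in \mathcal{T}$ and $h$ is an isomorphism of $\mathfrak{V}$ with $h \circ t$ defined (so all isomorphisms are transitions). For an object $X$, $\mathcal{T}(X)$ is the set of transitions with domain $X$. An evolution is a functor $\vec u$ from $\omega$ (as a poset category) to $\mathfrak{V}$, with objects $U_n$ and arrows $u_n^m\colon U_n \to U_m$ ($n \le m$), such that $U_0=\Theta$ and each $u_n^{n+1}$ is a transition. Standing assumption: every evolution has a colimit in $\mathfrak{V}$. A path is a finite composition of transitions. An object $X$ is finite if there is a path from $\Theta$ to $X$. Transition amalgamation property: for every two transitions $f,g$ with $\operatorname{dom}(f)=\operatorname{dom}(g)$ a finite object, there exist transitions $f',g'$ with $f'\circ f = g'\circ g$. Locally countable: for every finite object $X$ there is a countable set $\mathcal{F}(X)\subseteq \mathcal{T}(X)$ such that for every $f\in\mathcal{T}(X)$ there is an isomorphism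 $h$ with $h\circ f\in\mathcal{F}(X)$. An evolution $\vec u$ has the absorption property (for transitions) if for every $n\in\omega$ and every transition $t\colon U_n\to Y$ there are $m\ge n$ and a path $g\colon Y\to U_m$ such that $g\circ t = u_n^m$. The game $\operatorname{BM}(\mathcal{E},U)$ is played by two players, Eve and Odd. Eve starts by choosing a transition $e_0\colon\Theta\to A_0$. Odd responds with a transition $e_1\colon A_0\to A_1$, Eve responds with a transition $e_2\colon A_1\to A_2$, Odd responds with a transition $e_3\colon A_2\to A_3$, and so on. After infinitely many steps an evolution $\vec a$ ($\Theta\to A_0\to A_1\to\cdots$) is built. Odd wins if the colimit of $\vec a$ is isomorphic to $U$; otherwise Eve wins. *)

theory Defs
  imports Main "HOL-Library.Countable_Set"
begin

section \<open>Categories, functors and colimits\<close>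

record ('o, 'a) category =
  Ob   :: "'o set"
  Arr  :: "'a set"
  Dom  :: "'a \<Rightarrow> 'o"
  Cod  :: "'a \<Rightarrow> 'o"
  Id   :: "'o \<Rightarrow> 'a"
  Comp :: "'a \<Rightarrow> 'a \<Rightarrow> 'a"  (infixr \<open>\<odot>\<index>\<close> 70)

definition hom :: "('o, 'a, 'z) category_scheme \<Rightarrow> 'o \<Rightarrow> 'o \<Rightarrow> 'a set" where
  "hom C X Y = {f \<in> Arr C. Dom C f = X \<and> Cod C f = Y}"

text \<open>\<open>g \<odot>\<^bsub>C\<^esub> f\<close> is ``\<open>g\<close> after \<open>f\<close>''; nothing is said about it unless the arrows are composable.\<close>

locale category =
  fixes C :: "('o, 'a, 'z) category_scheme" (structure)
  assumes Dom_in: "f \<in> Arr C \<Longrightarrow> Dom C f \<in> Ob C"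
    and Cod_in: "f \<in> Arr C \<Longrightarrow> Cod C f \<in> Ob C"
    and Id_in: "X \<in> Ob C \<Longrightarrow> Id C X \<in> hom C X X"
    and Comp_in: "f \<in> hom C X Y \<Longrightarrow> g \<in> hom C Y Z \<Longrightarrow> g \<odot> f \<in> hom C X Z"
    and Comp_Id: "f \<in> hom C X Y \<Longrightarrow> f \<odot> Id C X = f"
    and Id_Comp: "f \<in> hom C X Y \<Longrightarrow> Id C Y \<odot> f = f"
    and Comp_assoc: "f \<in> hom C W X \<Longrightarrow> g \<in> hom C X Y \<Longrightarrow> h \<in> hom C Y Z
      \<Longrightarrow> (h \<odot> g) \<odot> f = h \<odot> (g \<odot> f)"

definition iso :: "('o, 'a, 'z) category_scheme \<Rightarrow> 'a \<Rightarrow> bool" where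
  "iso C h \<longleftrightarrow> h \<in> Arr C \<and>
     (\<exists>k \<in> hom C (Cod C h) (Dom C h).
        k \<odot>\<^bsub>C\<^esub> h = Id C (Dom C h) \<and> h \<odot>\<^bsub>C\<^esub> k = Id C (Cod C h))"

definition isomorphic :: "('o, 'a, 'z) category_scheme \<Rightarrow> 'o \<Rightarrow> 'o \<Rightarrow> bool" where
  "isomorphic C X Y \<longleftrightarrow> (\<exists>h \<in> hom C X Y. iso C h)"

record ('i, 'j, 'o, 'a) diagram =
  on_ob  :: "'i \<Rightarrow> 'o"
  on_arr :: "'j \<Rightarrow> 'a"

definition is_functor ::
  "('i, 'j, 'y) category_scheme \<Rightarrow> ('o, 'a, 'z) category_scheme \<Rightarrow> ('i, 'j, 'o, 'a) diagram \<Rightarrow> bool"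
where
  "is_functor J C F \<longleftrightarrow>
     (\<forall>i \<in> Ob J. on_ob F i \<in> Ob C) \<and>
     (\<forall>f \<in> Arr J. on_arr F f \<in> hom C (on_ob F (Dom J f)) (on_ob F (Cod J f))) \<and>
     (\<forall>i \<in> Ob J. on_arr F (Id J i) = Id C (on_ob F i)) \<and>
     (\<forall>f \<in> Arr J. \<forall>g \<in> Arr J. Dom J g = Cod J f \<longrightarrow>
        on_arr F (g \<odot>\<^bsub>J\<^esub> f) = on_arr F g \<odot>\<^bsub>C\<^esub> on_arr F f)"

definition cocone ::
  "('i, 'j, 'y) category_scheme \<Rightarrow> ('o, 'a, 'z) category_scheme \<Rightarrow> ('i, 'j, 'o, 'a) diagram
    \<Rightarrow> 'o \<Rightarrow> ('i \<Rightarrow> 'a) \<Rightarrow> bool"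
where
  "cocone J C F X c \<longleftrightarrow> X \<in> Ob C \<and>
     (\<forall>i \<in> Ob J. c i \<in> hom C (on_ob F i) X) \<and>
     (\<forall>f \<in> Arr J. c (Cod J f) \<odot>\<^bsub>C\<^esub> on_arr F f = c (Dom J f))"

definition colimit_cocone ::
  "('i, 'j, 'y) category_scheme \<Rightarrow> ('o, 'a, 'z) category_scheme \<Rightarrow> ('i, 'j, 'o, 'a) diagram
    \<Rightarrow> 'o \<Rightarrow> ('i \<Rightarrow> 'a) \<Rightarrow> bool"
where
  "colimit_cocone J C F X c \<longleftrightarrow> cocone J C F X c \<and>
     (\<forall>Y d. cocone J C F Y d \<longrightarrow>
        (\<exists>!h. h \<in> hom C X Y \<and> (\<forall>i \<in> Ob J. h \<odot>\<^bsub>C\<^esub> c i = d i)))"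

definition is_colimit ::
  "('i, 'j, 'y) category_scheme \<Rightarrow> ('o, 'a, 'z) category_scheme \<Rightarrow> ('i, 'j, 'o, 'a) diagram
    \<Rightarrow> 'o \<Rightarrow> bool"
where
  "is_colimit J C F X \<longleftrightarrow> (\<exists>c. colimit_cocone J C F X c)"

text \<open>The poset \<open>\<omega>\<close> as a category: the pair \<open>(n, m)\<close> is the unique arrow from \<open>n\<close> to \<open>m \<ge> n\<close>.\<close>

definition omega :: "(nat, nat \<times> nat) category" where
  "omega = \<lparr>Ob = UNIV, Arr = {(n, m). n \<le> m}, Dom = fst, Cod = snd,
            Id = (\<lambda>n. (n, n)), Comp = (\<lambda>g f. (fst f, snd g))\<rparr>"

lemma category_omega: "category omega"
  by unfold_locales (auto simp: omega_def hom_def)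


section \<open>Evolution systems\<close>

record ('o, 'a) evolution_system = "('o, 'a) category" +
  Trans  :: "'a set"
  Origin :: 'o

locale evolution_system = category E
  for E :: "('o, 'a, 'z) evolution_system_scheme" (structure) +
  assumes Origin_in: "Origin E \<in> Ob E"
    and Trans_subset: "Trans E \<subseteq> Arr E"
    and Id_Trans: "X \<in> Ob E \<Longrightarrow> Id E X \<in> Trans E"
    and iso_Comp_Trans: "t \<in> Trans E \<Longrightarrow> iso E h \<Longrightarrow> Dom E h = Cod E t \<Longrightarrow> h \<odot> t \<in> Trans E"

definition Trans_from :: "('o, 'a, 'z) evolution_system_scheme \<Rightarrow> 'o \<Rightarrow> 'a set" where
  "Trans_from E X = {t \<in> Trans E. Dom E t = X}"

text \<open>An evolution \<open>u\<close> has objects \<open>U\<^sub>n = on_ob u n\<close> and arrows \<open>on_arr u (n, m)\<close> from \<open>U\<^sub>n\<close> to \<open>U\<^sub>m\<close>.\<close>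

definition evolution ::
  "('o, 'a, 'z) evolution_system_scheme \<Rightarrow> (nat, nat \<times> nat, 'o, 'a) diagram \<Rightarrow> bool"
where
  "evolution E u \<longleftrightarrow> is_functor omega E u \<and> on_ob u 0 = Origin E \<and>
     (\<forall>n. on_arr u (n, Suc n) \<in> Trans E)"

definition evolutions_have_colimits :: "('o, 'a, 'z) evolution_system_scheme \<Rightarrow> bool" where
  "evolutions_have_colimits E \<longleftrightarrow> (\<forall>u. evolution E u \<longrightarrow> (\<exists>X. is_colimit omega E u X))"

text \<open>Compositions of one or more transitions. The empty composition at an object is its
  identity, which is itself a transition.\<close>

inductive is_path :: "('o, 'a, 'z) evolution_system_scheme \<Rightarrow> 'a \<Rightarrow> bool"
  for E :: "('o, 'a, 'z) evolution_system_scheme" where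
  single: "t \<in> Trans E \<Longrightarrow> is_path E t"
| step: "is_path E f \<Longrightarrow> t \<in> Trans E \<Longrightarrow> Dom E t = Cod E f \<Longrightarrow> is_path E (t \<odot>\<^bsub>E\<^esub> f)"

definition finite_object :: "('o, 'a, 'z) evolution_system_scheme \<Rightarrow> 'o \<Rightarrow> bool" where
  "finite_object E X \<longleftrightarrow> (\<exists>f \<in> hom E (Origin E) X. is_path E f)"

definition transition_amalgamation :: "('o, 'a, 'z) evolution_system_scheme \<Rightarrow> bool" where
  "transition_amalgamation E \<longleftrightarrow>
     (\<forall>f \<in> Trans E. \<forall>g \<in> Trans E. Dom E f = Dom E g \<and> finite_object E (Dom E f) \<longrightarrow>
        (\<exists>f' \<in> Trans_from E (Cod E f). \<exists>g' \<in> Trans_from E (Cod E g).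
           f' \<odot>\<^bsub>E\<^esub> f = g' \<odot>\<^bsub>E\<^esub> g))"

definition locally_countable :: "('o, 'a, 'z) evolution_system_scheme \<Rightarrow> bool" where
  "locally_countable E \<longleftrightarrow>
     (\<forall>X. finite_object E X \<longrightarrow>
        (\<exists>F \<subseteq> Trans_from E X. countable F \<and>
           (\<forall>f \<in> Trans_from E X. \<exists>h. iso E h \<and> Dom E h = Cod E f \<and> h \<odot>\<^bsub>E\<^esub> f \<in> F)))"

definition absorption_property ::
  "('o, 'a, 'z) evolution_system_scheme \<Rightarrow> (nat, nat \<times> nat, 'o, 'a) diagram \<Rightarrow> bool"
where
  "absorption_property E u \<longleftrightarrow>
     (\<forall>n. \<forall>t \<in> Trans_from E (on_ob u n). \<exists>m \<ge> n. \<exists>g \<in> hom E (Cod E t) (on_ob u m).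
        is_path E g \<and> g \<odot>\<^bsub>E\<^esub> t = on_arr u (n, m))"


section \<open>The game\<close>

text \<open>The moves are \<open>e 0, e 1, \<dots>\<close>, with Eve making the even-indexed and Odd the odd-indexed ones.
  \<open>stage E e n\<close> is the object from which move \<open>n\<close> starts: the origin for \<open>n = 0\<close>, and
  \<open>A\<^sub>n\<^sub>-\<^sub>1\<close> for \<open>n > 0\<close>.\<close>

definition stage :: "('o, 'a, 'z) evolution_system_scheme \<Rightarrow> (nat \<Rightarrow> 'a) \<Rightarrow> nat \<Rightarrow> 'o" where
  "stage E e n = (case n of 0 \<Rightarrow> Origin E | Suc k \<Rightarrow> Cod E (e k))"

definition legal_position :: "('o, 'a, 'z) evolution_system_scheme \<Rightarrow> 'a list \<Rightarrow> bool" where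
  "legal_position E es \<longleftrightarrow>
     (\<forall>i < length es. es ! i \<in> Trans_from E (stage E (\<lambda>k. es ! k) i))"

definition legal_run :: "('o, 'a, 'z) evolution_system_scheme \<Rightarrow> (nat \<Rightarrow> 'a) \<Rightarrow> bool" where
  "legal_run E e \<longleftrightarrow> (\<forall>i. e i \<in> Trans_from E (stage E e i))"

text \<open>\<open>run_comp E e n k\<close> is the composite of the \<open>k\<close> moves \<open>e n, \<dots>, e (n + k - 1)\<close>.\<close>

primrec run_comp :: "('o, 'a, 'z) evolution_system_scheme \<Rightarrow> (nat \<Rightarrow> 'a) \<Rightarrow> nat \<Rightarrow> nat \<Rightarrow> 'a" where
  "run_comp E e n 0 = Id E (stage E e n)"
| "run_comp E e n (Suc k) = e (n + k) \<odot>\<^bsub>E\<^esub> run_comp E e n k"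

definition run_evolution ::
  "('o, 'a, 'z) evolution_system_scheme \<Rightarrow> (nat \<Rightarrow> 'a) \<Rightarrow> (nat, nat \<times> nat, 'o, 'a) diagram"
where
  "run_evolution E e = \<lparr>on_ob = stage E e, on_arr = (\<lambda>(n, m). run_comp E e n (m - n))\<rparr>"

definition Odd_wins_run :: "('o, 'a, 'z) evolution_system_scheme \<Rightarrow> 'o \<Rightarrow> (nat \<Rightarrow> 'a) \<Rightarrow> bool" where
  "Odd_wins_run E U e \<longleftrightarrow> (\<exists>X. is_colimit omega E (run_evolution E e) X \<and> isomorphic E X U)"

text \<open>A strategy for Odd assigns a legal move to every legal position in which Odd is to move,
  that is, to every legal position of odd length.\<close>

definition Odd_strategy :: "('o, 'a, 'z) evolution_system_scheme \<Rightarrow> ('a list \<Rightarrow> 'a) \<Rightarrow> bool" where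
  "Odd_strategy E \<sigma> \<longleftrightarrow>
     (\<forall>es. legal_position E es \<and> odd (length es) \<longrightarrow> legal_position E (es @ [\<sigma> es]))"

definition follows_Odd_strategy :: "('a list \<Rightarrow> 'a) \<Rightarrow> (nat \<Rightarrow> 'a) \<Rightarrow> bool" where
  "follows_Odd_strategy \<sigma> e \<longleftrightarrow> (\<forall>n. odd n \<longrightarrow> e n = \<sigma> (map e [0..<n]))"

definition Odd_has_winning_strategy ::
  "('o, 'a, 'z) evolution_system_scheme \<Rightarrow> 'o \<Rightarrow> bool"
where
  "Odd_has_winning_strategy E U \<longleftrightarrow>
     (\<exists>\<sigma>. Odd_strategy E \<sigma> \<and>
        (\<forall>e. legal_run E e \<and> follows_Odd_strategy \<sigma> e \<longrightarrow> Odd_wins_run E U e))"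


text \<open>The diagram assigned to a legal run is indeed an evolution, with the moves as its steps.\<close>

context evolution_system
begin

lemma run_move_in_hom:
  "legal_run E e \<Longrightarrow> e n \<in> hom E (stage E e n) (stage E e (Suc n))"
  using Trans_subset unfolding legal_run_def Trans_from_def hom_def stage_def by auto

lemma stage_in: "legal_run E e \<Longrightarrow> stage E e n \<in> Ob E"
  using run_move_in_hom[of e n] Dom_in[of "e n"] unfolding hom_def by auto

lemma run_comp_in_hom:
  "legal_run E e \<Longrightarrow> run_comp E e n k \<in> hom E (stage E e n) (stage E e (n + k))"
proof (induction k)
  case 0
  then show ?case using Id_in[OF stage_in] by simp
next
  case (Suc k)
  then show ?case using Comp_in[OF Suc.IH run_move_in_hom] by simp
qed

lemma run_comp_add:
  assumes "legal_run E e"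
  shows "run_comp E e n (k + l) = run_comp E e (n + k) l \<odot> run_comp E e n k"
proof (induction l)
  case 0
  show ?case using Id_Comp[OF run_comp_in_hom[OF assms, of n k]] by simp
next
  case (Suc l)
  then show ?case
    using Comp_assoc[OF run_comp_in_hom[OF assms, of n k] run_comp_in_hom[OF assms, of "n + k" l]
        run_move_in_hom[OF assms, of "n + k + l"]]
    by (simp add: add.assoc)
qed

lemma evolution_run_evolution:
  assumes "legal_run E e"
  shows "evolution E (run_evolution E e)"
    and "on_arr (run_evolution E e) (n, Suc n) = e n"
proof -
  have step: "on_arr (run_evolution E e) (n, Suc n) = e n" for n
    by (simp add: run_evolution_def Comp_Id[OF run_move_in_hom[OF assms]])
  then show "on_arr (run_evolution E e) (n, Suc n) = e n" .
  have comp: "run_comp E e n (p - n) = run_comp E e m (p - m) \<odot> run_comp E e n (m - n)"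
    if "n \<le> m" "m \<le> p" for n m p
  proof -
    have "p - n = (m - n) + (p - m)" "n + (m - n) = m"
      using that by linarith+
    then show ?thesis
      by (metis run_comp_add[OF assms])
  qed
  have arr: "run_comp E e n (m - n) \<in> hom E (stage E e n) (stage E e m)" if "n \<le> m" for n m
    by (rule run_comp_in_hom[OF assms, of n "m - n", unfolded le_add_diff_inverse[OF that]])
  have "is_functor omega E (run_evolution E e)"
    unfolding is_functor_def
  proof (intro conjI ballI impI)
    fix i show "on_ob (run_evolution E e) i \<in> Ob E"
      by (simp add: run_evolution_def stage_in[OF assms])
  next
    fix f assume "f \<in> Arr omega"
    then show "on_arr (run_evolution E e) f
        \<in> hom E (on_ob (run_evolution E e) (Dom omega f)) (on_ob (run_evolution E e) (Cod omega f))"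
      by (cases f) (simp add: omega_def run_evolution_def arr)
  next
    fix i show "on_arr (run_evolution E e) (Id omega i) = Id E (on_ob (run_evolution E e) i)"
      by (simp add: omega_def run_evolution_def)
  next
    fix f g assume "f \<in> Arr omega" "g \<in> Arr omega" "Dom omega g = Cod omega f"
    then show "on_arr (run_evolution E e) (g \<odot>\<^bsub>omega\<^esub> f)
        = on_arr (run_evolution E e) g \<odot> on_arr (run_evolution E e) f"
      by (cases f; cases g) (auto simp: omega_def run_evolution_def intro: comp)
  qed
  moreover have "e n \<in> Trans E" for n
    using assms by (simp add: legal_run_def Trans_from_def)
  ultimately show "evolution E (run_evolution E e)"
    unfolding evolution_def step by (simp add: run_evolution_def stage_def)
qed

end

end

(* Local countability and amalgamation let either player, independently of the opponent, absorb the
   transitions from all stages one after the other: the player amalgamates the next transition from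
   an earlier stage with the composite of the moves made since then. So Eve can force the run to have
   the absorption property, and so can Odd. Moreover a back-and-forth between two evolutions with the
   absorption property shows that they have the same colimits. *)
theory Submission
  imports Defs "HOL-Library.Nat_Bijection"
begin

section \<open>Colimits of sequences\<close>

text \<open>Absorption produces paths, whereas a move must be a single transition. The amalgamation
  that is really needed is therefore lopsided: it completes a path and a transition to a square
  whose side parallel to the transition is again one transition. That side is a legal move when the
  path records the moves since stage \<open>n\<close>, and it is something an absorbing evolution
  can absorb when a path is being extended in the back-and-forth. A task is a pair
  \<open>(n, k)\<close>, the \<open>k\<close>-th listed transition at stage \<open>n\<close>. Its
  code is at least \<open>n\<close>, so the stage exists when the task falls due, once for each
  player. Transitions are listed only up to isomorphism; this suffices because isomorphisms are
  transitions, so one can be composed with an absorbing path. The back-and-forth gives maps only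
  between subsequences, and they compose to arrows of the evolutions rather than to identities.
  Hence the detour through morphisms of ind-objects.\<close>

lemma is_functor_omegaD:
  assumes "is_functor omega C u"
  shows "n \<le> m \<Longrightarrow> on_arr u (n, m) \<in> hom C (on_ob u n) (on_ob u m)"
    and "on_arr u (n, n) = Id C (on_ob u n)"
    and "n \<le> m \<Longrightarrow> m \<le> p \<Longrightarrow> on_arr u (m, p) \<odot>\<^bsub>C\<^esub> on_arr u (n, m) = on_arr u (n, p)"
proof -
  have arr: "on_arr u f \<in> hom C (on_ob u (Dom omega f)) (on_ob u (Cod omega f))"
    if "f \<in> Arr omega" for f
    using assms that unfolding is_functor_def by blast
  have id: "on_arr u (Id omega i) = Id C (on_ob u i)" if "i \<in> Ob omega" for i
    using assms that unfolding is_functor_def by blast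
  have comp: "on_arr u (g \<odot>\<^bsub>omega\<^esub> f) = on_arr u g \<odot>\<^bsub>C\<^esub> on_arr u f"
    if "f \<in> Arr omega" "g \<in> Arr omega" "Dom omega g = Cod omega f" for f g
    using assms that unfolding is_functor_def by blast
  show "on_arr u (n, m) \<in> hom C (on_ob u n) (on_ob u m)" if "n \<le> m"
    using arr[of "(n, m)"] that by (simp add: omega_def)
  show "on_arr u (n, n) = Id C (on_ob u n)"
    using id[of n] by (simp add: omega_def)
  show "on_arr u (m, p) \<odot>\<^bsub>C\<^esub> on_arr u (n, m) = on_arr u (n, p)" if "n \<le> m" "m \<le> p"
    using comp[of "(n, m)" "(m, p)"] that by (simp add: omega_def)
qed

lemma cocone_omega_iff:
  "cocone omega C u X c \<longleftrightarrow> X \<in> Ob C \<and> (\<forall>n. c n \<in> hom C (on_ob u n) X) \<and>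
     (\<forall>n m. n \<le> m \<longrightarrow> c m \<odot>\<^bsub>C\<^esub> on_arr u (n, m) = c n)"
  unfolding cocone_def omega_def by auto

text \<open>A morphism from \<open>u\<close> to \<open>v\<close> in the category of ind-objects, with chosen representatives.\<close>

definition ind_map ::
  "('o, 'a, 'z) category_scheme \<Rightarrow> (nat, nat \<times> nat, 'o, 'a) diagram \<Rightarrow> (nat, nat \<times> nat, 'o, 'a) diagram
    \<Rightarrow> (nat \<Rightarrow> nat) \<Rightarrow> (nat \<Rightarrow> 'a) \<Rightarrow> bool"
where
  "ind_map C u v b f \<longleftrightarrow> mono b \<and> (\<forall>i. f i \<in> hom C (on_ob u i) (on_ob v (b i))) \<and>
     (\<forall>i j. i \<le> j \<longrightarrow> f j \<odot>\<^bsub>C\<^esub> on_arr u (i, j) = on_arr v (b i, b j) \<odot>\<^bsub>C\<^esub> f i)"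

context category
begin

lemma cocone_ind_map:
  assumes u: "is_functor omega C u" and v: "is_functor omega C v"
    and f: "ind_map C u v b f" and c: "cocone omega C v X c"
  shows "cocone omega C u X (\<lambda>i. c (b i) \<odot> f i)"
  unfolding cocone_omega_iff
proof (intro conjI allI impI)
  have ch: "c n \<in> hom C (on_ob v n) X" for n
    using c unfolding cocone_omega_iff by blast
  have fh: "f i \<in> hom C (on_ob u i) (on_ob v (b i))" for i
    using f unfolding ind_map_def by blast
  show "X \<in> Ob C"
    using c unfolding cocone_omega_iff by blast
  show "c (b n) \<odot> f n \<in> hom C (on_ob u n) X" for n
    by (rule Comp_in[OF fh ch])
  show "(c (b m) \<odot> f m) \<odot> on_arr u (n, m) = c (b n) \<odot> f n" if "n \<le> m" for n m
  proof -
    have bnm: "b n \<le> b m"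
      using f that unfolding ind_map_def by (blast dest: monoD)
    have "(c (b m) \<odot> f m) \<odot> on_arr u (n, m) = c (b m) \<odot> (f m \<odot> on_arr u (n, m))"
      by (rule Comp_assoc[OF is_functor_omegaD(1)[OF u that] fh ch])
    also have "\<dots> = c (b m) \<odot> (on_arr v (b n, b m) \<odot> f n)"
      using f that unfolding ind_map_def by simp
    also have "\<dots> = (c (b m) \<odot> on_arr v (b n, b m)) \<odot> f n"
      by (rule Comp_assoc[OF fh is_functor_omegaD(1)[OF v bnm] ch, symmetric])
    also have "\<dots> = c (b n) \<odot> f n"
      using c bnm unfolding cocone_omega_iff by simp
    finally show ?thesis .
  qed
qed

text \<open>The composite of \<open>f\<close> and \<open>g\<close> is only an arrow of
  \<open>u\<close>, not an identity, but a cocone cannot see the difference: pulling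
  \<open>c\<close> back along \<open>g\<close> and then along \<open>f\<close> returns
  \<open>c\<close>.\<close>

lemma cocone_ind_map_inverse:
  assumes f: "ind_map C u v b f" and g: "ind_map C v u a g" and c: "cocone omega C u X c"
    and gf: "g (b i) \<odot> f i = on_arr u (i, a (b i))" and ab: "i \<le> a (b i)"
  shows "(c (a (b i)) \<odot> g (b i)) \<odot> f i = c i"
proof -
  have "(c (a (b i)) \<odot> g (b i)) \<odot> f i = c (a (b i)) \<odot> (g (b i) \<odot> f i)"
    using f g c unfolding ind_map_def cocone_omega_iff by (intro Comp_assoc) blast+
  then show ?thesis
    using c ab unfolding gf cocone_omega_iff by simp
qed

text \<open>Pulling back along \<open>f\<close> and \<open>g\<close> turns cocones under
  \<open>v\<close> into cocones under \<open>u\<close> and conversely, with the vertex unchanged. By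
  the preceding lemma the two operations are mutually inverse, so a universal cocone goes to a
  universal one.\<close>

lemma is_colimit_ind_iso:
  assumes u: "is_functor omega C u" and v: "is_functor omega C v"
    and f: "ind_map C u v b f" and g: "ind_map C v u a g"
    and gf: "\<And>i. i \<le> a (b i)" "\<And>i. g (b i) \<odot> f i = on_arr u (i, a (b i))"
    and fg: "\<And>j. j \<le> b (a j)" "\<And>j. f (a j) \<odot> g j = on_arr v (j, b (a j))"
    and X: "is_colimit omega C u X"
  shows "is_colimit omega C v X"
proof -
  obtain c where c: "colimit_cocone omega C u X c"
    using X unfolding is_colimit_def by blast
  then have cu: "cocone omega C u X c"
    unfolding colimit_cocone_def by blast
  have ch: "c n \<in> hom C (on_ob u n) X" for n
    using cu unfolding cocone_omega_iff by blast
  have fh: "f i \<in> hom C (on_ob u i) (on_ob v (b i))" for i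
    using f unfolding ind_map_def by blast
  have gh: "g i \<in> hom C (on_ob v i) (on_ob u (a i))" for i
    using g unfolding ind_map_def by blast
  define d where "d = (\<lambda>j. c (a j) \<odot> g j)"
  have dv: "cocone omega C v X d"
    unfolding d_def by (rule cocone_ind_map[OF v u g cu])
  have dh: "d j \<in> hom C (on_ob v j) X" for j
    using dv unfolding cocone_omega_iff by blast
  have "\<exists>!h. h \<in> hom C X Y \<and> (\<forall>i. h \<odot> d i = y i)" if y: "cocone omega C v Y y" for Y y
  proof -
    have yh: "y n \<in> hom C (on_ob v n) Y" for n
      using y unfolding cocone_omega_iff by blast
    \<comment> \<open>Both conditions select the same arrows \<open>h\<close>, so unique existence
      is inherited from \<open>c\<close>.\<close>
    have iff: "(\<forall>i. h \<odot> d i = y i) \<longleftrightarrow> (\<forall>i. h \<odot> c i = y (b i) \<odot> f i)"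
      if h: "h \<in> hom C X Y" for h
    proof
      assume hd: "\<forall>i. h \<odot> d i = y i"
      show "\<forall>i. h \<odot> c i = y (b i) \<odot> f i"
      proof
        fix i
        have "d (b i) \<odot> f i = c i"
          unfolding d_def by (rule cocone_ind_map_inverse[OF f g cu gf(2) gf(1)])
        then show "h \<odot> c i = y (b i) \<odot> f i"
          using Comp_assoc[OF fh dh h, of i] hd by simp
      qed
    next
      assume hc: "\<forall>i. h \<odot> c i = y (b i) \<odot> f i"
      show "\<forall>i. h \<odot> d i = y i"
      proof
        fix j
        have "(y (b (a j)) \<odot> f (a j)) \<odot> g j = y j"
          by (rule cocone_ind_map_inverse[OF g f y fg(2) fg(1)])
        then show "h \<odot> d j = y j"
          using Comp_assoc[OF gh ch h, of j] hc by (simp add: d_def)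
      qed
    qed
    have "\<exists>!h. h \<in> hom C X Y \<and> (\<forall>i. h \<odot> c i = y (b i) \<odot> f i)"
      using c cocone_ind_map[OF u v f y] unfolding colimit_cocone_def by (simp add: omega_def)
    then show ?thesis
      using iff by (smt (verit))
  qed
  then have "colimit_cocone omega C v X d"
    using dv unfolding colimit_cocone_def by (simp add: omega_def)
  then show ?thesis
    unfolding is_colimit_def by blast
qed

lemma isomorphic_refl:
  assumes "X \<in> Ob C"
  shows "isomorphic C X X"
proof -
  note id = Id_in[OF assms]
  then have "Id C X \<in> Arr C" "Dom C (Id C X) = X" "Cod C (Id C X) = X"
    by (simp_all add: hom_def)
  then have "iso C (Id C X)"
    unfolding iso_def using id Comp_Id[OF id] by auto
  then show ?thesis
    unfolding isomorphic_def using id by blast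
qed

text \<open>Odd wins as soon as some colimit is isomorphic to \<open>U\<close>, but the evolution
  sought must have \<open>U\<close> itself as a colimit.\<close>

lemma is_colimit_isomorphic:
  assumes u: "is_functor omega C u" and X: "is_colimit omega C u X" and XU: "isomorphic C X U"
  shows "is_colimit omega C u U"
proof -
  obtain c where c: "colimit_cocone omega C u X c"
    using X unfolding is_colimit_def by blast
  then have cu: "cocone omega C u X c"
    unfolding colimit_cocone_def by blast
  have ch: "c n \<in> hom C (on_ob u n) X" for n
    using cu unfolding cocone_omega_iff by blast
  obtain s r where s: "s \<in> hom C X U" and r: "r \<in> hom C U X"
    and rs: "r \<odot> s = Id C X" and sr: "s \<odot> r = Id C U"
    using XU unfolding isomorphic_def iso_def hom_def by auto
  have U: "U \<in> Ob C"
    using s Cod_in unfolding hom_def by auto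
  have "cocone omega C u U (\<lambda>n. s \<odot> c n)"
    unfolding cocone_omega_iff
  proof (intro conjI allI impI)
    show "U \<in> Ob C" by (rule U)
    show "s \<odot> c n \<in> hom C (on_ob u n) U" for n
      by (rule Comp_in[OF ch s])
    show "(s \<odot> c m) \<odot> on_arr u (n, m) = s \<odot> c n" if "n \<le> m" for n m
      using Comp_assoc[OF is_functor_omegaD(1)[OF u that] ch s] cu that
      unfolding cocone_omega_iff by simp
  qed
  moreover have "\<exists>!h. h \<in> hom C U Y \<and> (\<forall>i. h \<odot> (s \<odot> c i) = y i)"
    if y: "cocone omega C u Y y" for Y y
  proof -
    have "\<exists>!k. k \<in> hom C X Y \<and> (\<forall>i. k \<odot> c i = y i)"
      using c y unfolding colimit_cocone_def by (simp add: omega_def)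
    then obtain k where k: "k \<in> hom C X Y" "\<And>i. k \<odot> c i = y i"
      and uniq: "\<And>k'. k' \<in> hom C X Y \<Longrightarrow> (\<forall>i. k' \<odot> c i = y i) \<Longrightarrow> k' = k"
      by blast
    show ?thesis
    proof (intro ex1I[of _ "k \<odot> r"] conjI allI)
      show "k \<odot> r \<in> hom C U Y" by (rule Comp_in[OF r k(1)])
      have krs: "(k \<odot> r) \<odot> s = k"
        using Comp_assoc[OF s r k(1)] rs Comp_Id[OF k(1)] by simp
      show "(k \<odot> r) \<odot> (s \<odot> c i) = y i" for i
        using Comp_assoc[OF ch s Comp_in[OF r k(1)], of i] krs k(2) by simp
    next
      fix h assume h: "h \<in> hom C U Y \<and> (\<forall>i. h \<odot> (s \<odot> c i) = y i)"
      then have hU: "h \<in> hom C U Y" by blast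
      have "h \<odot> s = k"
        using Comp_assoc[OF ch s hU] h by (intro uniq Comp_in[OF s hU]) simp
      then show "h = k \<odot> r"
        using Comp_assoc[OF r s hU] sr Comp_Id[OF hU] by simp
    qed
  qed
  ultimately have "colimit_cocone omega C u U (\<lambda>n. s \<odot> c n)"
    unfolding colimit_cocone_def by (simp add: omega_def)
  then show ?thesis
    unfolding is_colimit_def by blast
qed

end

section \<open>Paths and absorption\<close>

context evolution_system
begin

lemma Arr_hom: "f \<in> Arr E \<Longrightarrow> f \<in> hom E (Dom E f) (Cod E f)"
  by (simp add: hom_def)

lemma Comp_Arr:
  assumes "f \<in> Arr E" "g \<in> Arr E" "Dom E g = Cod E f"
  shows "g \<odot> f \<in> Arr E" "Dom E (g \<odot> f) = Dom E f" "Cod E (g \<odot> f) = Cod E g"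
  using Comp_in[of f "Dom E f" "Cod E f" g "Cod E g"] assms by (auto simp: hom_def)

lemma is_path_Arr: "is_path E p \<Longrightarrow> p \<in> Arr E"
proof (induction rule: is_path.induct)
  case (single t)
  then show ?case using Trans_subset by blast
next
  case (step f t)
  then show ?case using Trans_subset by (intro Comp_Arr(1)) auto
qed

lemma iso_Trans:
  assumes "iso E h"
  shows "h \<in> Trans E"
proof -
  have h: "h \<in> hom E (Dom E h) (Cod E h)"
    using assms by (simp add: iso_def hom_def)
  then have X: "Dom E h \<in> Ob E"
    by (simp add: hom_def Dom_in)
  then have "h \<odot> Id E (Dom E h) \<in> Trans E"
    using assms Id_in[OF X] by (intro iso_Comp_Trans Id_Trans) (auto simp: hom_def)
  then show ?thesis
    using Comp_Id[OF h] by simp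
qed

lemma is_path_Comp:
  assumes "is_path E g" "is_path E f" "Dom E g = Cod E f"
  shows "is_path E (g \<odot> f)"
  using assms
proof (induction rule: is_path.induct)
  case (single t)
  then show ?case by (intro is_path.step)
next
  case (step g t)
  have arr: "f \<in> Arr E" "g \<in> Arr E" "t \<in> Arr E"
    using step is_path_Arr Trans_subset by auto
  have dom: "Dom E g = Cod E f"
    using step Comp_Arr(2)[OF arr(2,3)] by simp
  have "t \<odot> (g \<odot> f) = (t \<odot> g) \<odot> f"
    using arr dom step.hyps by (intro Comp_assoc[symmetric]) (auto simp: hom_def)
  moreover have "is_path E (t \<odot> (g \<odot> f))"
    using step dom Comp_Arr(3)[OF arr(1,2) dom] by (intro is_path.step[of _ "g \<odot> f"]) auto
  ultimately show ?case by simp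
qed

lemma finite_object_Cod:
  assumes "finite_object E (Dom E p)" "is_path E p"
  shows "finite_object E (Cod E p)"
proof -
  obtain f where f: "f \<in> hom E (Origin E) (Dom E p)" "is_path E f"
    using assms unfolding finite_object_def by blast
  have "p \<odot> f \<in> hom E (Origin E) (Cod E p)"
    by (rule Comp_in[OF f(1) Arr_hom[OF is_path_Arr[OF assms(2)]]])
  moreover have "is_path E (p \<odot> f)"
    using f by (intro is_path_Comp[OF assms(2)]) (simp_all add: hom_def)
  ultimately show ?thesis
    unfolding finite_object_def by blast
qed

text \<open>Amalgamation squares are glued along \<open>p\<close>. Each square replaces the current
  transition by one parallel to it, while the sides parallel to \<open>p\<close> accumulate into the
  path \<open>p'\<close>. All sources along the way are finite, being reached by paths from a finite
  object.\<close>

lemma amalgamate_path: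
  assumes am: "transition_amalgamation E"
    and "is_path E p" "t \<in> Trans E" "Dom E t = Dom E p" "finite_object E (Dom E p)"
  shows "\<exists>t' \<in> Trans_from E (Cod E p). \<exists>p' \<in> hom E (Cod E t) (Cod E t').
    is_path E p' \<and> t' \<odot> p = p' \<odot> t"
  using assms(2-)
proof (induction rule: is_path.induct)
  case (single p)
  then obtain t' p' where t': "t' \<in> Trans_from E (Cod E p)" "p' \<in> Trans_from E (Cod E t)"
    and eq: "t' \<odot> p = p' \<odot> t"
    using am unfolding transition_amalgamation_def by metis
  have arr: "p \<in> Arr E" "t \<in> Arr E" "t' \<in> Arr E" "p' \<in> Arr E"
    using single t' Trans_subset unfolding Trans_from_def by auto
  \<comment> \<open>The amalgamation property merely equates two composites; the common codomain is
    read off from that equation.\<close>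
  have "Cod E p' = Cod E t'"
    using Comp_Arr(3)[OF arr(1,3)] Comp_Arr(3)[OF arr(2,4)] eq t' by (simp add: Trans_from_def)
  then show ?case
    using t' eq arr is_path.single[of p' E] unfolding Trans_from_def hom_def by blast
next
  case (step p s)
  have arr: "p \<in> Arr E" "s \<in> Arr E" "t \<in> Arr E"
    using step is_path_Arr Trans_subset by auto
  have dom: "Dom E (s \<odot> p) = Dom E p" "Cod E (s \<odot> p) = Cod E s"
    using Comp_Arr[OF arr(1,2) step.hyps(3)] by auto
  obtain t1 p1 where t1: "t1 \<in> Trans_from E (Cod E p)" and p1: "p1 \<in> hom E (Cod E t) (Cod E t1)"
    "is_path E p1" and eq1: "t1 \<odot> p = p1 \<odot> t"
    using step dom by auto
  have "finite_object E (Cod E p)"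
    using step dom finite_object_Cod by simp
  then obtain t2 s2 where t2: "t2 \<in> Trans_from E (Cod E s)" and s2: "s2 \<in> Trans_from E (Cod E t1)"
    and eq2: "t2 \<odot> s = s2 \<odot> t1"
    using am step t1 unfolding transition_amalgamation_def Trans_from_def by force
  have arr': "t1 \<in> Arr E" "t2 \<in> Arr E" "s2 \<in> Arr E" "p1 \<in> Arr E"
    using t1 t2 s2 p1 Trans_subset unfolding Trans_from_def hom_def by auto
  have ends: "Dom E t1 = Cod E p" "Dom E t2 = Cod E s" "Dom E s2 = Cod E t1"
    "Dom E p1 = Cod E t" "Cod E p1 = Cod E t1"
    using t1 t2 s2 p1 unfolding Trans_from_def hom_def by auto
  have "Cod E s2 = Cod E t2"
    using Comp_Arr(3)[OF arr(2) arr'(2)] Comp_Arr(3)[OF arr'(1,3)] eq2 ends by simp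
  then have "s2 \<odot> p1 \<in> hom E (Cod E t) (Cod E t2)"
    using Comp_Arr[OF arr'(4,3)] ends by (simp add: hom_def)
  moreover have "is_path E (s2 \<odot> p1)"
    using p1 s2 ends by (intro is_path.step) (auto simp: Trans_from_def)
  moreover have "t2 \<odot> (s \<odot> p) = (s2 \<odot> p1) \<odot> t"
  proof -
    have "t2 \<odot> (s \<odot> p) = (t2 \<odot> s) \<odot> p"
      using arr arr' ends step.hyps by (intro Comp_assoc[symmetric]) (auto simp: hom_def)
    also have "\<dots> = s2 \<odot> (t1 \<odot> p)"
      unfolding eq2 using arr arr' ends by (intro Comp_assoc) (auto simp: hom_def)
    also have "\<dots> = (s2 \<odot> p1) \<odot> t"
      unfolding eq1 using arr arr' ends by (intro Comp_assoc[symmetric]) (auto simp: hom_def)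
    finally show ?thesis .
  qed
  ultimately show ?case
    using t2 dom by auto
qed

lemma evolution_functor: "evolution E u \<Longrightarrow> is_functor omega E u"
  by (simp add: evolution_def)

lemmas evolution_hom = is_functor_omegaD(1)[OF evolution_functor]
  and evolution_Id = is_functor_omegaD(2)[OF evolution_functor]
  and evolution_Comp = is_functor_omegaD(3)[OF evolution_functor]

lemma evolution_Ob: "evolution E u \<Longrightarrow> on_ob u n \<in> Ob E"
  using evolution_hom[of u n n] Dom_in[of "on_arr u (n, n)"] by (simp add: hom_def)

lemma is_path_evolution:
  assumes u: "evolution E u" and "n \<le> m"
  shows "is_path E (on_arr u (n, m))"
  using assms(2)
proof (induction rule: dec_induct)
  case base
  then show ?case
    using evolution_Id[OF u] Id_Trans[OF evolution_Ob[OF u]] by (simp add: is_path.single)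
next
  case (step k)
  have "is_path E (on_arr u (k, Suc k) \<odot> on_arr u (n, k))"
    using u step evolution_hom[OF u, of n k] evolution_hom[OF u, of k "Suc k"]
    by (intro is_path.step) (auto simp: evolution_def hom_def)
  then show ?case
    using evolution_Comp[OF u, of n k "Suc k"] step by simp
qed

lemma finite_object_evolution:
  assumes u: "evolution E u"
  shows "finite_object E (on_ob u n)"
  using is_path_evolution[OF u, of 0 n] evolution_hom[OF u, of 0 n] u
  unfolding finite_object_def evolution_def by auto

text \<open>If \<open>g\<close> already absorbs \<open>p\<close> into \<open>on_ob u m\<close>, the
  next transition \<open>t\<close> is pushed along \<open>g\<close> to a transition starting at
  \<open>on_ob u m\<close>, and the absorption property handles that one. The strict inequality
  makes the indices of the back-and-forth strictly increasing.\<close>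

lemma absorb_path:
  assumes am: "transition_amalgamation E" and u: "evolution E u" and ab: "absorption_property E u"
    and "is_path E p" "Dom E p = on_ob u n"
  shows "\<exists>m > n. \<exists>g \<in> hom E (Cod E p) (on_ob u m). is_path E g \<and> g \<odot> p = on_arr u (n, m)"
  using assms(4-)
proof (induction rule: is_path.induct)
  case (single t)
  then have "t \<in> Trans_from E (on_ob u n)"
    by (simp add: Trans_from_def)
  then obtain m g where m: "n \<le> m" and g: "g \<in> hom E (Cod E t) (on_ob u m)" "is_path E g"
    and eq: "g \<odot> t = on_arr u (n, m)"
    using ab unfolding absorption_property_def by blast
  \<comment> \<open>One more step of \<open>u\<close> turns \<open>m \<ge> n\<close> into a strict
    inequality.\<close>
  let ?s = "on_arr u (m, Suc m)"
  have s: "?s \<in> hom E (on_ob u m) (on_ob u (Suc m))" "is_path E ?s"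
    using evolution_hom[OF u] is_path_evolution[OF u] by auto
  have t: "t \<in> hom E (on_ob u n) (Cod E t)"
    using single Trans_subset by (auto simp: hom_def)
  have "(?s \<odot> g) \<odot> t = on_arr u (n, Suc m)"
    using Comp_assoc[OF t g(1) s(1)] eq evolution_Comp[OF u m, of "Suc m"] by simp
  moreover have "is_path E (?s \<odot> g)"
    using is_path_Comp[OF s(2) g(2)] s(1) g(1) by (simp add: hom_def)
  moreover have "Suc m > n"
    using m by simp
  ultimately show ?case
    using Comp_in[OF g(1) s(1)] by blast
next
  case (step p t)
  have arr: "p \<in> Arr E" "t \<in> Arr E"
    using step is_path_Arr Trans_subset by auto
  have dom: "Dom E (t \<odot> p) = Dom E p" "Cod E (t \<odot> p) = Cod E t"
    using Comp_Arr[OF arr step.hyps(3)] by auto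
  obtain m g where m: "n < m" and g: "g \<in> hom E (Cod E p) (on_ob u m)" "is_path E g"
    and eq: "g \<odot> p = on_arr u (n, m)"
    using step dom by auto
  have "finite_object E (Cod E p)"
    using step dom finite_object_Cod finite_object_evolution[OF u] by simp
  then obtain t' g' where t': "t' \<in> Trans_from E (Cod E g)"
    and g': "g' \<in> hom E (Cod E t) (Cod E t')" "is_path E g'" and eq': "t' \<odot> g = g' \<odot> t"
    using amalgamate_path[OF am g(2) step.hyps(2)] step.hyps(3) g(1) unfolding hom_def by auto
  have t'_from: "t' \<in> Trans_from E (on_ob u m)"
    using t' g(1) by (simp add: hom_def)
  then obtain k h where k: "m \<le> k" and h: "h \<in> hom E (Cod E t') (on_ob u k)" "is_path E h"
    and eq'': "h \<odot> t' = on_arr u (m, k)"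
    using ab unfolding absorption_property_def by blast
  have ph: "p \<in> hom E (on_ob u n) (Cod E p)" and th: "t \<in> hom E (Cod E p) (Cod E t)"
    and t'h: "t' \<in> hom E (on_ob u m) (Cod E t')"
    using arr step dom t'_from Trans_subset unfolding hom_def Trans_from_def by auto
  note hg' = Comp_in[OF g'(1) h(1)]
  have "(h \<odot> g') \<odot> (t \<odot> p) = ((h \<odot> g') \<odot> t) \<odot> p"
    by (rule Comp_assoc[OF ph th hg', symmetric])
  also have "\<dots> = (h \<odot> (t' \<odot> g)) \<odot> p"
    using Comp_assoc[OF th g'(1) h(1)] eq' by simp
  also have "\<dots> = on_arr u (m, k) \<odot> (g \<odot> p)"
    using Comp_assoc[OF g(1) t'h h(1)] eq''
      Comp_assoc[OF ph g(1) evolution_hom[OF u k]] by simp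
  also have "\<dots> = on_arr u (n, k)"
    using eq evolution_Comp[OF u _ k, of n] m by simp
  finally have "(h \<odot> g') \<odot> (t \<odot> p) = on_arr u (n, k)" .
  moreover have "is_path E (h \<odot> g')"
    using is_path_Comp[OF h(2) g'(2)] h(1) g'(1) by (simp add: hom_def)
  moreover have "k > n"
    using m k by simp
  ultimately show ?case
    using hg' dom by auto
qed

section \<open>Back-and-forth between two absorbing evolutions\<close>

text \<open>Any zigzag \<open>F k : U\<^bsub>a k\<^esub> \<rightarrow> V\<^bsub>b k\<^esub>\<close>, \<open>G k : V\<^bsub>b k\<^esub> \<rightarrow> U\<^bsub>a (k + 1)\<^esub>\<close> gives one half of an
  isomorphism of ind-objects; the other half comes from the zigzag started at \<open>G 0\<close>.\<close>

lemma ind_map_zigzag: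
  assumes u: "evolution E u" and v: "evolution E v"
    and a: "strict_mono a" and b: "strict_mono b"
    and F: "\<And>k. F k \<in> hom E (on_ob u (a k)) (on_ob v (b k))"
    and nat: "\<And>k. F (Suc k) \<odot> on_arr u (a k, a (Suc k)) = on_arr v (b k, b (Suc k)) \<odot> F k"
  shows "k \<le> l \<Longrightarrow> F l \<odot> on_arr u (a k, a l) = on_arr v (b k, b l) \<odot> F k"
    and "ind_map E u v b (\<lambda>i. F i \<odot> on_arr u (i, a i))"
proof -
  have am: "a i \<le> a j" and bm: "b i \<le> b j" if "i \<le> j" for i j
    using that a b by (simp_all add: strict_mono_less_eq)
  have ai: "i \<le> a i" for i
    by (rule strict_mono_imp_increasing[OF a])
  show natl: "F l \<odot> on_arr u (a k, a l) = on_arr v (b k, b l) \<odot> F k" if "k \<le> l" for k l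
    using that
  proof (induction rule: dec_induct)
    case base
    then show ?case
      using Comp_Id[OF F] Id_Comp[OF F] evolution_Id[OF u] evolution_Id[OF v] by simp
  next
    case (step l)
    have kl: "k \<le> l" "l \<le> Suc l"
      using step by auto
    note ukl = evolution_hom[OF u am[OF kl(1)]] and ul = evolution_hom[OF u am[OF kl(2)]]
    note vkl = evolution_hom[OF v bm[OF kl(1)]] and vl = evolution_hom[OF v bm[OF kl(2)]]
    have "F (Suc l) \<odot> on_arr u (a k, a (Suc l))
        = F (Suc l) \<odot> (on_arr u (a l, a (Suc l)) \<odot> on_arr u (a k, a l))"
      using evolution_Comp[OF u am[OF kl(1)] am[OF kl(2)]] by simp
    also have "\<dots> = (on_arr v (b l, b (Suc l)) \<odot> F l) \<odot> on_arr u (a k, a l)"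
      using Comp_assoc[OF ukl ul F] nat by simp
    also have "\<dots> = on_arr v (b l, b (Suc l)) \<odot> (on_arr v (b k, b l) \<odot> F k)"
      using Comp_assoc[OF ukl F vl] step.IH by simp
    also have "\<dots> = on_arr v (b k, b (Suc l)) \<odot> F k"
      using Comp_assoc[OF F vkl vl] evolution_Comp[OF v bm[OF kl(1)] bm[OF kl(2)]] by simp
    finally show ?case .
  qed
  show "ind_map E u v b (\<lambda>i. F i \<odot> on_arr u (i, a i))"
    unfolding ind_map_def
  proof (intro conjI allI impI)
    show "mono b"
      using b by (rule strict_mono_mono)
    show "F i \<odot> on_arr u (i, a i) \<in> hom E (on_ob u i) (on_ob v (b i))" for i
      by (rule Comp_in[OF evolution_hom[OF u ai] F])
    show "(F j \<odot> on_arr u (j, a j)) \<odot> on_arr u (i, j)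
        = on_arr v (b i, b j) \<odot> (F i \<odot> on_arr u (i, a i))" if ij: "i \<le> j" for i j
    proof -
      have "(F j \<odot> on_arr u (j, a j)) \<odot> on_arr u (i, j)
          = F j \<odot> on_arr u (i, a j)"
        using Comp_assoc[OF evolution_hom[OF u ij] evolution_hom[OF u ai] F]
          evolution_Comp[OF u ij ai] by simp
      also have "\<dots> = F j \<odot> (on_arr u (a i, a j) \<odot> on_arr u (i, a i))"
        using evolution_Comp[OF u ai am[OF ij]] by simp
      also have "\<dots> = (on_arr v (b i, b j) \<odot> F i) \<odot> on_arr u (i, a i)"
        using Comp_assoc[OF evolution_hom[OF u ai] evolution_hom[OF u am[OF ij]] F] natl[OF ij]
        by simp
      also have "\<dots> = on_arr v (b i, b j) \<odot> (F i \<odot> on_arr u (i, a i))"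
        by (rule Comp_assoc[OF evolution_hom[OF u ai] F evolution_hom[OF v bm[OF ij]]])
      finally show ?thesis .
    qed
  qed
qed

text \<open>The shift \<open>s = 0\<close> gives the composite at \<open>U\<close>. Exchanging \<open>F\<close> and \<open>G\<close> gives the one at \<open>V\<close>, where
  \<open>G k\<close> is followed by \<open>F (k + 1)\<close>, so \<open>s = 1\<close>.\<close>

lemma zigzag_inverse:
  assumes u: "evolution E u" and v: "evolution E v"
    and a: "strict_mono a" and c: "strict_mono c" and d: "strict_mono d"
    and F: "\<And>k. F k \<in> hom E (on_ob u (a k)) (on_ob v (b k))"
    and G: "\<And>k. G k \<in> hom E (on_ob v (c k)) (on_ob u (d k))"
    and natG: "\<And>k. G (Suc k) \<odot> on_arr v (c k, c (Suc k)) = on_arr u (d k, d (Suc k)) \<odot> G k"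
    and shift: "\<And>k. c (k + s) = b k" "\<And>k. k + s \<le> b k" "\<And>k. a k \<le> d (k + s)"
    and GF: "\<And>k. G (k + s) \<odot> F k = on_arr u (a k, d (k + s))"
  shows "(G (b i) \<odot> on_arr v (b i, c (b i))) \<odot> (F i \<odot> on_arr u (i, a i)) = on_arr u (i, d (b i))"
proof -
  have ai: "i \<le> a i"
    by (rule strict_mono_imp_increasing[OF a])
  have le: "d (i + s) \<le> d (b i)"
    using shift(2) d by (simp add: strict_mono_less_eq)
  note ui = evolution_hom[OF u ai] and ud = evolution_hom[OF u le]
  have Gh: "G (i + s) \<in> hom E (on_ob v (b i)) (on_ob u (d (i + s)))"
    using G[of "i + s"] shift(1) by simp
  \<comment> \<open>Since \<open>c (i + s) = b i\<close>, \<open>G (i + s)\<close> starts where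
    \<open>F i\<close> ends. Naturality slides \<open>G\<close> back from index \<open>b i\<close>
    to \<open>i + s\<close>, so that \<open>GF\<close> applies.\<close>
  have "(G (b i) \<odot> on_arr v (b i, c (b i))) \<odot> (F i \<odot> on_arr u (i, a i))
      = (on_arr u (d (i + s), d (b i)) \<odot> G (i + s)) \<odot> (F i \<odot> on_arr u (i, a i))"
    using ind_map_zigzag(1)[where F = G, OF v u c d G natG shift(2)[of i]] shift(1) by simp
  also have "\<dots> = ((on_arr u (d (i + s), d (b i)) \<odot> G (i + s)) \<odot> F i) \<odot> on_arr u (i, a i)"
    by (rule Comp_assoc[OF ui F Comp_in[OF Gh ud], symmetric])
  also have "\<dots> = (on_arr u (d (i + s), d (b i)) \<odot> on_arr u (a i, d (i + s))) \<odot> on_arr u (i, a i)"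
    using Comp_assoc[OF F Gh ud] GF by simp
  also have "\<dots> = on_arr u (i, d (b i))"
    using evolution_Comp[OF u shift(3) le] evolution_Comp[OF u ai le_trans[OF shift(3) le]] by simp
  finally show ?thesis .
qed

text \<open>Each map is a path, so it can be absorbed by the evolution from which it starts; the
  absorbing map is again a path, now in the opposite direction, and the roles alternate
  forever.\<close>

lemma absorption_zigzag:
  assumes am: "transition_amalgamation E"
    and u: "evolution E u" and abu: "absorption_property E u"
    and v: "evolution E v" and abv: "absorption_property E v"
  shows "\<exists>a b F G. strict_mono a \<and> strict_mono b \<and>
    (\<forall>k. F k \<in> hom E (on_ob u (a k)) (on_ob v (b k)) \<and>
         G k \<in> hom E (on_ob v (b k)) (on_ob u (a (Suc k))) \<and>
         G k \<odot> F k = on_arr u (a k, a (Suc k)) \<and>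
         F (Suc k) \<odot> G k = on_arr v (b k, b (Suc k)))"
proof -
  \<comment> \<open>A state is a path \<open>p\<close> from \<open>on_ob u n\<close> to
    \<open>on_ob v m\<close>. One step covers a full round trip, so the returning map
    \<open>g\<close> is hidden in \<open>R\<close> and recovered by choice at the end.\<close>
  define P where "P = (\<lambda>(n, m, p). p \<in> hom E (on_ob u n) (on_ob v m) \<and> is_path E p)"
  define R where "R = (\<lambda>(n, m, p) (n', m', p'). n < n' \<and> m < m' \<and>
    (\<exists>g \<in> hom E (on_ob v m) (on_ob u n'). g \<odot> p = on_arr u (n, n') \<and> p' \<odot> g = on_arr v (m, m')))"
  \<comment> \<open>Both evolutions begin at the origin, so its identity starts the zigzag.\<close>
  have "P (0, 0, Id E (Origin E))"
    using Id_in[OF Origin_in] is_path.single[OF Id_Trans[OF Origin_in]] u v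
    by (simp add: P_def evolution_def)
  moreover have "\<exists>y. P y \<and> R x y" if "P x" for x
  proof (cases x)
    case (fields n m p)
    then have p: "p \<in> hom E (on_ob u n) (on_ob v m)" "is_path E p"
      using that by (auto simp: P_def)
    obtain n' g where n': "n < n'" and g: "g \<in> hom E (on_ob v m) (on_ob u n')" "is_path E g"
      and gp: "g \<odot> p = on_arr u (n, n')"
      using absorb_path[OF am u abu p(2), of n] p(1) by (auto simp: hom_def)
    obtain m' p' where m': "m < m'" and p': "p' \<in> hom E (on_ob u n') (on_ob v m')" "is_path E p'"
      and pg: "p' \<odot> g = on_arr v (m, m')"
      using absorb_path[OF am v abv g(2), of m] g(1) by (auto simp: hom_def)
    have "P (n', m', p')" "R x (n', m', p')"
      using fields n' m' g gp p' pg by (auto simp: P_def R_def)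
    then show ?thesis by blast
  qed
  ultimately obtain s where s: "\<And>k. P (s k)" "\<And>k. R (s k) (s (Suc k))"
    using dependent_nat_choice[of "\<lambda>_. P" "\<lambda>_. R"] by blast
  define a where "a = (\<lambda>k. fst (s k))"
  define b where "b = (\<lambda>k. fst (snd (s k)))"
  define F where "F = (\<lambda>k. snd (snd (s k)))"
  have s_eq: "s k = (a k, b k, F k)" for k
    by (simp add: a_def b_def F_def)
  have F: "F k \<in> hom E (on_ob u (a k)) (on_ob v (b k))" for k
    using s(1)[of k] by (simp add: P_def s_eq)
  have R: "a k < a (Suc k) \<and> b k < b (Suc k) \<and>
    (\<exists>g \<in> hom E (on_ob v (b k)) (on_ob u (a (Suc k))).
       g \<odot> F k = on_arr u (a k, a (Suc k)) \<and> F (Suc k) \<odot> g = on_arr v (b k, b (Suc k)))" for k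
    using s(2)[of k] by (simp add: R_def s_eq)
  then have "\<forall>k. \<exists>g. g \<in> hom E (on_ob v (b k)) (on_ob u (a (Suc k))) \<and>
       g \<odot> F k = on_arr u (a k, a (Suc k)) \<and> F (Suc k) \<odot> g = on_arr v (b k, b (Suc k))"
    by blast
  then obtain G where G: "\<forall>k. G k \<in> hom E (on_ob v (b k)) (on_ob u (a (Suc k))) \<and>
       G k \<odot> F k = on_arr u (a k, a (Suc k)) \<and> F (Suc k) \<odot> G k = on_arr v (b k, b (Suc k))"
    by (rule choice[THEN exE])
  have "strict_mono a" "strict_mono b"
    using R by (simp_all add: strict_mono_Suc_iff)
  then show ?thesis
    using F G by blast
qed

lemma absorption_colimit_unique:
  assumes am: "transition_amalgamation E"
    and u: "evolution E u" and abu: "absorption_property E u"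
    and v: "evolution E v" and abv: "absorption_property E v"
    and X: "is_colimit omega E u X"
  shows "is_colimit omega E v X"
proof -
  obtain a b F G where a: "strict_mono a" and b: "strict_mono b"
    and F: "\<And>k. F k \<in> hom E (on_ob u (a k)) (on_ob v (b k))"
    and G: "\<And>k. G k \<in> hom E (on_ob v (b k)) (on_ob u (a (Suc k)))"
    and GF: "\<And>k. G k \<odot> F k = on_arr u (a k, a (Suc k))"
    and FG: "\<And>k. F (Suc k) \<odot> G k = on_arr v (b k, b (Suc k))"
    using absorption_zigzag[OF am u abu v abv] by blast
  \<comment> \<open>\<open>G k\<close> ends at index \<open>a (Suc k)\<close> of \<open>u\<close>;
    the shift makes the zigzag starting at \<open>G 0\<close> an instance of the same
    pattern.\<close>
  define a' where "a' = (\<lambda>k. a (Suc k))"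
  have a': "strict_mono a'"
    using a by (simp add: a'_def strict_mono_def)
  have G': "G k \<in> hom E (on_ob v (b k)) (on_ob u (a' k))" for k
    using G by (simp add: a'_def)
  have aa': "a k \<le> a' k" and bb: "b k \<le> b (Suc k)" and kb: "k \<le> b k" and ka': "Suc k \<le> a' k"
    for k
    using a b strict_mono_imp_increasing[OF a, of "Suc k"] strict_mono_imp_increasing[OF b, of k]
    by (simp_all add: a'_def strict_mono_less_eq)
  \<comment> \<open>Both sides equal the threefold composite of \<open>F k\<close>,
    \<open>G k\<close> and \<open>F (Suc k)\<close>.\<close>
  have natF: "F (Suc k) \<odot> on_arr u (a k, a (Suc k)) = on_arr v (b k, b (Suc k)) \<odot> F k" for k
    using Comp_assoc[OF F[of k] G[of k] F[of "Suc k"]] GF[of k] FG[of k] by simp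
  have natG: "G (Suc k) \<odot> on_arr v (b k, b (Suc k)) = on_arr u (a' k, a' (Suc k)) \<odot> G k" for k
    using Comp_assoc[OF G[of k] F[of "Suc k"] G[of "Suc k"]] GF[of "Suc k"] FG[of k]
    by (simp add: a'_def)
  show ?thesis
  proof (rule is_colimit_ind_iso[OF evolution_functor[OF u] evolution_functor[OF v] _ _ _ _ _ _ X])
    show "ind_map E u v b (\<lambda>i. F i \<odot> on_arr u (i, a i))"
      by (rule ind_map_zigzag(2)[where F = F, OF u v a b F natF])
    show "ind_map E v u a' (\<lambda>j. G j \<odot> on_arr v (j, b j))"
      by (rule ind_map_zigzag(2)[where F = G, OF v u b a' G' natG])
    show "i \<le> a' (b i)" for i
      using kb[of i] ka'[of "b i"] by simp
    show "j \<le> b (a' j)" for j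
      using kb[of "a' j"] ka'[of j] by simp
    show "(G (b i) \<odot> on_arr v (b i, b (b i))) \<odot> (F i \<odot> on_arr u (i, a i)) = on_arr u (i, a' (b i))"
      for i
      by (rule zigzag_inverse[where s = 0 and F = F and G = G, OF u v a b a' F G' natG])
        (use kb aa' GF in \<open>simp_all add: a'_def\<close>)
    show "(F (a' j) \<odot> on_arr u (a' j, a (a' j))) \<odot> (G j \<odot> on_arr v (j, b j)) = on_arr v (j, b (a' j))"
      for j
      by (rule zigzag_inverse[where s = 1 and F = G and G = F, OF v u b a b G' F natF])
        (use bb ka' FG in \<open>simp_all add: a'_def\<close>)
  qed
qed

end

section \<open>Bookkeeping strategies\<close>

lemma stage_cong: "(\<And>k. k < n \<Longrightarrow> e k = e' k) \<Longrightarrow> stage E e n = stage E e' n"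
  by (simp add: stage_def split: nat.split)

lemma run_comp_cong:
  "(\<And>k. k < n + l \<Longrightarrow> e k = e' k) \<Longrightarrow> run_comp E e n l = run_comp E e' n l"
  by (induction l) (simp_all add: stage_cong[of n e e'])

lemma legal_position_map_iff:
  "legal_position E (map e [0..<n]) \<longleftrightarrow> (\<forall>i<n. e i \<in> Trans_from E (stage E e i))"
proof -
  have "stage E (\<lambda>k. map e [0..<n] ! k) i = stage E e i" if "i < n" for i
    by (rule stage_cong) (use that in auto)
  then show ?thesis
    by (simp add: legal_position_def)
qed

lemma legal_run_iff: "legal_run E e \<longleftrightarrow> (\<forall>n. legal_position E (map e [0..<n]))"
  unfolding legal_position_map_iff legal_run_def by blast

section \<open>Enumerating transitions and serving tasks\<close>

text \<open>The enumeration is total, with repetitions allowed, so that every pair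
  \<open>(n, k)\<close> is a meaningful task.\<close>

definition enumerates_transitions ::
  "('o, 'a, 'z) evolution_system_scheme \<Rightarrow> ('o \<Rightarrow> nat \<Rightarrow> 'a) \<Rightarrow> bool"
where
  "enumerates_transitions E \<tau> \<longleftrightarrow> (\<forall>X. finite_object E X \<longrightarrow>
     (\<forall>k. \<tau> X k \<in> Trans_from E X) \<and>
     (\<forall>f \<in> Trans_from E X. \<exists>k h. iso E h \<and> Dom E h = Cod E f \<and> h \<odot>\<^bsub>E\<^esub> f = \<tau> X k))"

text \<open>Both moves \<open>2 j\<close> and \<open>2 j + 1\<close> serve the task coded
  by \<open>j\<close>, as only one of them is under the control of a given player.\<close>

definition serves_task ::
  "('o, 'a, 'z) evolution_system_scheme \<Rightarrow> ('o \<Rightarrow> nat \<Rightarrow> 'a) \<Rightarrow> (nat \<Rightarrow> 'a) \<Rightarrow> nat \<Rightarrow> bool"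
where
  "serves_task E \<tau> e N \<longleftrightarrow>
     (case prod_decode (N div 2) of (n, k) \<Rightarrow>
        \<exists>g \<in> hom E (Cod E (\<tau> (stage E e n) k)) (stage E e (Suc N)).
          is_path E g \<and> g \<odot>\<^bsub>E\<^esub> \<tau> (stage E e n) k = run_comp E e n (Suc N - n))"

text \<open>A task never refers to a stage that is not yet built when its code comes up.\<close>

lemma prod_decode_le: "prod_decode j = (n, k) \<Longrightarrow> n \<le> j"
  by (metis le_prod_encode_1 prod_decode_inverse)

text \<open>Service at move \<open>N\<close> depends only on the moves up to \<open>N\<close>, so it
  makes sense for a finite position continued arbitrarily.\<close>

lemma serves_task_cong:
  assumes "\<And>k. k \<le> N \<Longrightarrow> e k = e' k"
  shows "serves_task E \<tau> e N \<longleftrightarrow> serves_task E \<tau> e' N"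
proof -
  obtain n k where nk: "prod_decode (N div 2) = (n, k)"
    by fastforce
  then have n: "n \<le> N"
    using prod_decode_le[OF nk] by simp
  have "stage E e n = stage E e' n" "stage E e (Suc N) = stage E e' (Suc N)"
    using assms n by (auto intro: stage_cong)
  moreover have "run_comp E e n (Suc N - n) = run_comp E e' n (Suc N - n)"
    using assms n by (intro run_comp_cong) auto
  ultimately show ?thesis
    by (simp add: serves_task_def nk)
qed

text \<open>Every move depends on all earlier ones, so the recursion runs over positions:
  \<open>pre n\<close> is the position before move \<open>n\<close>.\<close>

lemma ex_run_of_strategy: "\<exists>e. \<forall>n. e n = mv (map e [0..<n])"
proof -
  define pre where "pre = rec_nat [] (\<lambda>_ es. es @ [mv es])"
  have pre: "pre 0 = []" "pre (Suc n) = pre n @ [mv (pre n)]" for n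
    by (simp_all add: pre_def)
  have "pre n = map (\<lambda>k. mv (pre k)) [0..<n]" for n
    by (induction n) (simp_all add: pre)
  then have "mv (pre n) = mv (map (\<lambda>k. mv (pre k)) [0..<n])" for n
    by (rule arg_cong)
  then show ?thesis
    by (intro exI allI)
qed

context evolution_system
begin

text \<open>Facts about stages and composites are available for infinite legal runs; this transfers
  them to finite positions.\<close>

lemma legal_position_extend:
  assumes "legal_position E es"
  obtains e where "legal_run E e" "map e [0..<length es] = es"
proof
  let ?N = "length es"
  let ?S = "stage E (\<lambda>k. es ! k)"
  \<comment> \<open>Identities are transitions, so the play can idle forever at the last
    stage.\<close>
  define e where "e = (\<lambda>k. if k < ?N then es ! k else Id E (?S ?N))"
  have moves: "es ! i \<in> Trans_from E (?S i)" if "i < ?N" for i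
    using assms that by (simp add: legal_position_def)
  have "?S ?N \<in> Ob E"
  proof (cases ?N)
    case 0
    then show ?thesis by (simp add: stage_def Origin_in)
  next
    case (Suc k)
    then show ?thesis
      using moves[of k] Trans_subset Cod_in by (auto simp: stage_def Trans_from_def)
  qed
  then have id: "Id E (?S ?N) \<in> Trans_from E (?S ?N)" "Cod E (Id E (?S ?N)) = ?S ?N"
    using Id_Trans Id_in by (auto simp: Trans_from_def hom_def)
  have before: "stage E e i = ?S i" if "i \<le> ?N" for i
    by (rule stage_cong) (use that in \<open>simp add: e_def\<close>)
  have after: "stage E e i = ?S ?N" if i: "?N \<le> i" for i
  proof (cases "i = ?N")
    case False
    then obtain k where "i = Suc k" "?N \<le> k"
      using i by (cases i) (auto simp: le_Suc_eq)
    then show ?thesis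
      using id by (simp add: stage_def e_def)
  qed (use before[of i] in simp)
  show "legal_run E e"
    unfolding legal_run_def
  proof
    show "e i \<in> Trans_from E (stage E e i)" for i
      using moves[of i] before[of i] after[of i] id by (cases "i < ?N") (simp_all add: e_def)
  qed
  show "map e [0..<?N] = es"
    by (rule nth_equalityI) (simp_all add: e_def)
qed

lemma is_path_run_comp:
  assumes e: "legal_run E e" and "n \<le> N"
  shows "is_path E (run_comp E e n (N - n))"
    and "run_comp E e n (N - n) \<in> hom E (stage E e n) (stage E e N)"
  using is_path_evolution[OF evolution_run_evolution(1)[OF e] assms(2)] run_comp_in_hom[OF e, of n "N - n"]
    assms(2) by (simp_all add: run_evolution_def)

lemma finite_object_stage: "legal_run E e \<Longrightarrow> finite_object E (stage E e n)"
  using finite_object_evolution[OF evolution_run_evolution(1), of e n] by (simp add: run_evolution_def)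

lemma locally_countable_enumeration:
  assumes "locally_countable E"
  shows "\<exists>\<tau>. enumerates_transitions E \<tau>"
proof -
  obtain F where F: "\<And>X. finite_object E X \<Longrightarrow> F X \<subseteq> Trans_from E X \<and> countable (F X) \<and>
      (\<forall>f \<in> Trans_from E X. \<exists>h. iso E h \<and> Dom E h = Cod E f \<and> h \<odot> f \<in> F X)"
    using assms unfolding locally_countable_def by metis
  \<comment> \<open>The identity has an isomorphic copy in \<open>F X\<close>. Nonemptiness is what
    makes \<open>from_nat_into\<close> take all its values in \<open>F X\<close>.\<close>
  have ne: "F X \<noteq> {}" if X: "finite_object E X" for X
  proof -
    have "X \<in> Ob E"
      using X Cod_in unfolding finite_object_def hom_def by auto
    then have "Id E X \<in> Trans_from E X"
      using Id_Trans Id_in by (auto simp: Trans_from_def hom_def)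
    then show ?thesis
      using F[OF X] by blast
  qed
  have "enumerates_transitions E (\<lambda>X. from_nat_into (F X))"
    unfolding enumerates_transitions_def
  proof (intro allI impI conjI ballI)
    show "from_nat_into (F X) k \<in> Trans_from E X" if "finite_object E X" for X k
      using F[OF that] from_nat_into[OF ne[OF that]] by blast
    show "\<exists>k h. iso E h \<and> Dom E h = Cod E f \<and> h \<odot> f = from_nat_into (F X) k"
      if "finite_object E X" "f \<in> Trans_from E X" for X f
      using F[OF that(1)] that(2) from_nat_into_to_nat_on by metis
  qed
  then show ?thesis by blast
qed

text \<open>The task's transition at stage \<open>n\<close> is amalgamated with the path of moves
  \<open>n\<close> to \<open>N - 1\<close>. The transition side of the square is the move, and its
  path side is the absorbing path.\<close>

lemma ex_serving_move:
  assumes am: "transition_amalgamation E"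
    and \<tau>: "enumerates_transitions E \<tau>"
    and e: "legal_run E e"
  shows "\<exists>t \<in> Trans_from E (stage E e N). serves_task E \<tau> (e(N := t)) N"
proof -
  obtain n k where nk: "prod_decode (N div 2) = (n, k)"
    by fastforce
  then have n: "n \<le> N"
    using prod_decode_le[OF nk] by simp
  let ?f = "\<tau> (stage E e n) k" and ?p = "run_comp E e n (N - n)"
  have f: "?f \<in> Trans E" "Dom E ?f = stage E e n"
    using \<tau> finite_object_stage[OF e] by (simp_all add: enumerates_transitions_def Trans_from_def)
  have p: "is_path E ?p" "Dom E ?p = stage E e n" "Cod E ?p = stage E e N"
    using is_path_run_comp[OF e n] by (simp_all add: hom_def)
  obtain t g where t: "t \<in> Trans_from E (stage E e N)" and g: "g \<in> hom E (Cod E ?f) (Cod E t)"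
    "is_path E g" and eq: "t \<odot> ?p = g \<odot> ?f"
    using amalgamate_path[OF am p(1) f(1)] f p finite_object_stage[OF e, of n] by auto
  let ?e = "e(N := t)"
  have "stage E ?e n = stage E e n"
    by (rule stage_cong) (use n in auto)
  moreover have "stage E ?e (Suc N) = Cod E t"
    by (simp add: stage_def)
  moreover have "run_comp E ?e n (Suc N - n) = t \<odot> ?p"
  proof -
    have "run_comp E ?e n (N - n) = ?p"
      by (rule run_comp_cong) (use n in auto)
    then show ?thesis
      using n by (simp add: Suc_diff_le)
  qed
  ultimately have "serves_task E \<tau> ?e N"
    using g eq by (auto simp: serves_task_def nk)
  then show ?thesis
    using t by blast
qed

text \<open>The reply \<open>\<beta>\<close> serves its task after any legal history, not only after
  one that followed \<open>\<beta>\<close>. It can therefore be used by either player at that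
  player's own moves.\<close>

lemma bookkeeping_strategy:
  assumes am: "transition_amalgamation E"
    and \<tau>: "enumerates_transitions E \<tau>"
  shows "\<exists>\<beta>. (\<forall>es. legal_position E es \<longrightarrow> legal_position E (es @ [\<beta> es])) \<and>
    (\<forall>e N. legal_run E e \<longrightarrow> e N = \<beta> (map e [0..<N]) \<longrightarrow> serves_task E \<tau> e N)"
proof -
  \<comment> \<open>Entries of \<open>(es @ [t]) ! k\<close> beyond the list are unspecified, but
    service at move \<open>length es\<close> does not read them.\<close>
  have "\<exists>t. legal_position E (es @ [t]) \<and> serves_task E \<tau> (\<lambda>k. (es @ [t]) ! k) (length es)"
    if es: "legal_position E es" for es
  proof -
    let ?N = "length es"
    obtain e where e: "legal_run E e" and es_eq: "map e [0..<?N] = es"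
      using legal_position_extend[OF es] by blast
    obtain t where t: "t \<in> Trans_from E (stage E e ?N)" and serve: "serves_task E \<tau> (e(?N := t)) ?N"
      using ex_serving_move[OF am \<tau> e] by blast
    have "map (e(?N := t)) [0..<?N] = map e [0..<?N]"
      by (rule map_cong) auto
    then have app: "es @ [t] = map (e(?N := t)) [0..<Suc ?N]"
      using es_eq by simp
    have stage: "stage E (e(?N := t)) i = stage E e i" if "i \<le> ?N" for i
      by (rule stage_cong) (use that in auto)
    have "legal_position E (es @ [t])"
      unfolding app legal_position_map_iff
      using e t stage by (auto simp: less_Suc_eq legal_run_def)
    moreover have "serves_task E \<tau> (\<lambda>k. (es @ [t]) ! k) ?N"
      using serve unfolding app
      by (subst serves_task_cong[of _ _ "e(?N := t)"]) (simp_all del: upt_Suc)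
    ultimately show ?thesis by blast
  qed
  then obtain \<beta> where \<beta>: "\<And>es. legal_position E es \<Longrightarrow> legal_position E (es @ [\<beta> es]) \<and>
      serves_task E \<tau> (\<lambda>k. (es @ [\<beta> es]) ! k) (length es)"
    by metis
  have "serves_task E \<tau> e N" if e: "legal_run E e" and eN: "e N = \<beta> (map e [0..<N])" for e N
  proof -
    have "map e [0..<N] @ [\<beta> (map e [0..<N])] = map e [0..<Suc N]"
      using eN by simp
    then have "serves_task E \<tau> (\<lambda>k. map e [0..<Suc N] ! k) N"
      using \<beta>[of "map e [0..<N]"] e unfolding legal_run_iff by (metis diff_zero length_map length_upt)
    then show ?thesis
      by (subst (asm) serves_task_cong[of _ _ e]) (simp_all del: upt_Suc)
  qed
  then show ?thesis
    using \<beta> by blast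
qed

text \<open>\<open>r\<close> tells whose moves do the serving: 0 for Eve, 1 for Odd. Serving the
  listed copy \<open>h \<odot> t\<close> also absorbs \<open>t\<close>, by the path
  \<open>g \<odot> h\<close>.\<close>

lemma serves_tasks_absorption:
  assumes \<tau>: "enumerates_transitions E \<tau>"
    and e: "legal_run E e" and "r < 2" and serve: "\<And>j. serves_task E \<tau> e (2 * j + r)"
  shows "absorption_property E (run_evolution E e)"
  unfolding absorption_property_def
proof (intro allI ballI)
  fix n t assume "t \<in> Trans_from E (on_ob (run_evolution E e) n)"
  then have t: "t \<in> Trans_from E (stage E e n)"
    by (simp add: run_evolution_def)
  then obtain k h where h: "iso E h" "Dom E h = Cod E t" and ht: "h \<odot> t = \<tau> (stage E e n) k"
    using \<tau> finite_object_stage[OF e] unfolding enumerates_transitions_def by blast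
  \<comment> \<open>The move at which the player indicated by \<open>r\<close> serves
    \<open>(n, k)\<close>; halving it recovers the code because \<open>r < 2\<close>.\<close>
  define N where "N = 2 * prod_encode (n, k) + r"
  have nk: "prod_decode (N div 2) = (n, k)"
    using assms(3) by (simp add: N_def)
  have n: "n \<le> Suc N"
    using prod_decode_le[OF nk] by simp
  obtain g where g: "g \<in> hom E (Cod E (\<tau> (stage E e n) k)) (stage E e (Suc N))" "is_path E g"
    and eq: "g \<odot> \<tau> (stage E e n) k = run_comp E e n (Suc N - n)"
    using serve[of "prod_encode (n, k)"] nk by (auto simp: serves_task_def N_def[symmetric])
  have th: "t \<in> hom E (stage E e n) (Cod E t)" "h \<in> hom E (Cod E t) (Cod E h)" "h \<in> Trans E"
    using t h iso_Trans Trans_subset by (auto simp: Trans_from_def hom_def)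
  have gh: "g \<in> hom E (Cod E h) (stage E e (Suc N))"
    using g(1) Comp_in[OF th(1,2)] unfolding ht hom_def by simp
  have "g \<odot> h \<in> hom E (Cod E t) (stage E e (Suc N))"
    by (rule Comp_in[OF th(2) gh])
  moreover have "is_path E (g \<odot> h)"
    using is_path_Comp[OF g(2) is_path.single[OF th(3)]] gh by (simp add: hom_def)
  moreover have "(g \<odot> h) \<odot> t = run_comp E e n (Suc N - n)"
    using Comp_assoc[OF th(1,2) gh] ht eq by simp
  ultimately show "\<exists>m\<ge>n. \<exists>g\<in>hom E (Cod E t) (on_ob (run_evolution E e) m).
      is_path E g \<and> g \<odot> t = on_arr (run_evolution E e) (n, m)"
    using n unfolding run_evolution_def by auto
qed

section \<open>The two implications\<close>

text \<open>Eve plays \<open>\<beta>\<close> against a winning strategy \<open>\<sigma>\<close>. The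
  single resulting run has the absorption property by her moves and colimit \<open>U\<close> by
  his.\<close>

lemma absorbing_evolution_of_winning_strategy:
  assumes lc: "locally_countable E" and am: "transition_amalgamation E"
    and win: "Odd_has_winning_strategy E U"
  shows "\<exists>u. evolution E u \<and> absorption_property E u \<and> is_colimit omega E u U"
proof -
  obtain \<tau> where \<tau>: "enumerates_transitions E \<tau>"
    using locally_countable_enumeration[OF lc] by blast
  obtain \<beta> where \<beta>: "\<And>es. legal_position E es \<Longrightarrow> legal_position E (es @ [\<beta> es])"
    "\<And>e N. legal_run E e \<Longrightarrow> e N = \<beta> (map e [0..<N]) \<Longrightarrow> serves_task E \<tau> e N"
    using bookkeeping_strategy[OF am \<tau>] by blast
  obtain \<sigma> where \<sigma>: "Odd_strategy E \<sigma>"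
    "\<And>e. legal_run E e \<Longrightarrow> follows_Odd_strategy \<sigma> e \<Longrightarrow> Odd_wins_run E U e"
    using win unfolding Odd_has_winning_strategy_def by blast
  obtain e where "\<forall>n. e n = (\<lambda>es. if even (length es) then \<beta> es else \<sigma> es) (map e [0..<n])"
    using ex_run_of_strategy[of "\<lambda>es. if even (length es) then \<beta> es else \<sigma> es"] by blast
  then have eN: "e n = (if even n then \<beta> (map e [0..<n]) else \<sigma> (map e [0..<n]))" for n
    by simp
  have "legal_position E (map e [0..<n])" for n
  proof (induction n)
    case 0
    show ?case by (simp add: legal_position_def)
  next
    case (Suc n)
    then show ?case
      using \<beta>(1)[OF Suc] \<sigma>(1) eN[of n] by (auto simp: Odd_strategy_def)
  qed
  then have run: "legal_run E e"
    by (simp add: legal_run_iff)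
  note ev = evolution_run_evolution(1)[OF run]
  have "serves_task E \<tau> e (2 * j + 0)" for j
    using eN[of "2 * j"] by (intro \<beta>(2)[OF run]) simp
  then have "absorption_property E (run_evolution E e)"
    by (rule serves_tasks_absorption[OF \<tau> run, rotated]) simp
  moreover have "follows_Odd_strategy \<sigma> e"
    using eN by (simp add: follows_Odd_strategy_def)
  then have "is_colimit omega E (run_evolution E e) U"
    using \<sigma>(2)[OF run] is_colimit_isomorphic[OF evolution_functor[OF ev]]
    unfolding Odd_wins_run_def by blast
  ultimately show ?thesis
    using ev by blast
qed

text \<open>Odd plays \<open>\<beta>\<close>, which does not mention \<open>U\<close> or
  \<open>u\<close>. Whatever Eve does, the run has the absorption property, and so it shares its
  colimits with \<open>u\<close>.\<close>

lemma winning_strategy_of_absorbing_evolution: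
  assumes lc: "locally_countable E" and am: "transition_amalgamation E" and U: "U \<in> Ob E"
    and u: "evolution E u" "absorption_property E u" and colim: "is_colimit omega E u U"
  shows "Odd_has_winning_strategy E U"
proof -
  obtain \<tau> where \<tau>: "enumerates_transitions E \<tau>"
    using locally_countable_enumeration[OF lc] by blast
  obtain \<beta> where \<beta>: "\<And>es. legal_position E es \<Longrightarrow> legal_position E (es @ [\<beta> es])"
    "\<And>e N. legal_run E e \<Longrightarrow> e N = \<beta> (map e [0..<N]) \<Longrightarrow> serves_task E \<tau> e N"
    using bookkeeping_strategy[OF am \<tau>] by blast
  have "Odd_wins_run E U e" if run: "legal_run E e" and follows: "follows_Odd_strategy \<beta> e" for e
  proof -
    note ev = evolution_run_evolution(1)[OF run]
    have "serves_task E \<tau> e (2 * j + 1)" for j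
      using follows by (intro \<beta>(2)[OF run]) (simp add: follows_Odd_strategy_def)
    then have "absorption_property E (run_evolution E e)"
      by (rule serves_tasks_absorption[OF \<tau> run, rotated]) simp
    then have "is_colimit omega E (run_evolution E e) U"
      by (rule absorption_colimit_unique[OF am u ev _ colim])
    then show ?thesis
      using isomorphic_refl[OF U] unfolding Odd_wins_run_def by blast
  qed
  then show ?thesis
    using \<beta>(1) unfolding Odd_has_winning_strategy_def Odd_strategy_def by blast
qed

end

theorem theorem4p11:
  fixes E :: "('o, 'a) evolution_system" and U :: 'o
  assumes "evolution_system E"
    and "evolutions_have_colimits E"
    and "locally_countable E"
    and "transition_amalgamation E"
    and "U \<in> Ob E"
  shows "Odd_has_winning_strategy E U \<longleftrightarrow>
    (\<exists>u. evolution E u \<and> absorption_property E u \<and> is_colimit omega E u U)"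
  using evolution_system.absorbing_evolution_of_winning_strategy[OF assms(1,3,4)]
    evolution_system.winning_strategy_of_absorbing_evolution[OF assms(1,3,4,5)]
  by blast

end
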